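(* Let $\gamma$ be a space curve in the normal form described in the context (with $a_2>0$, $b_3\ge 0$), let $\xi_1=(1,0,0)$ be the tangent direction of $\gamma$ at $0$, let $\mu$ be the cuspidal curvature at $0$ of the singular plane curve $\gamma_{\xi_1}$, and let $$\xi_2=(\sin\theta_1\cos\theta_2,\ \sin\theta_1\sin\theta_2,\ \cos\theta_1)$$ be a unit vector, not tangent to $\gamma$ at $0$, where $\theta_1,\theta_2$ are known. Let $\kappa_{\xi_2}$ be the curvature of the plane curve $\gamma_{\xi_2}$ as a function of its arc-length parameter. Suppose that $\cos\theta_1\neq 0$. Then the following hold. (1) The coefficients $a_2$ and $b_3$ are uniquely determined by the cuspidal curvature $\mu$ and the $0$-th order information of $\kappa_{\xi_2}$ at $0$. (2) In addition to (1), $a_3$ is uniquely determined by the cuspidal curvature $\mu$ and the first order information of $\kappa_{\xi_2}$ at $0$.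
   Context: For a unit vector $\xi\in\mathbb{R}^3$, $\pi_\xi(x)=x-\langle x,\xi\rangle\xi:\mathbb{R}^3\to\xi^\perp$ is the orthogonal projection in the direction $\xi$, and $\gamma_\xi=\pi_\xi\circ\gamma$. Cuspidal curvature: a plane curve $c:I\to\mathbb{R}^2$ with $c'(0)=0$ is of $A$-type at $0$ if $c''(0)\neq0$; its cuspidal curvature at $0$ is $\mu=\det(c''(0),c'''(0))/|c''(0)|^{5/2}$. Setting: $I$ is an open interval containing $0$ and $\gamma:I\to\mathbb{R}^3$ is a regular $C^\infty$ curve with $\gamma(0)=(0,0,0)$ and non-zero curvature at $0$. The vector $\xi_1$ is tangent to $\gamma$ at $0$, so $\gamma_{\xi_1}$ is a singular plane curve of $A$-type at $0$. It is assumed that there is an integer $N$ such that $\det((\gamma_{\xi_1})'',(\gamma_{\xi_1})^{(i)})(0)=0$ for $i=3,5,\ldots,2N-1$ and $\det((\gamma_{\xi_1})'',(\gamma_{\xi_1})^{(2N+1)})(0)\neq0$. A positively oriented $xyz$-coordinate system of $\mathbb{R}^3$ is taken with the $x$-axis in the direction of $\xi_1$ and the $y$-axis in the direction of $(\gamma_{\xi_1})''(0)$, and $yz$ are used as coordinates of $\xi_1^\perp$. The curve $\gamma_{\xi_1}$ is oriented so that $\det((\gamma_{\xi_1})'',(\gamma_{\xi_1})^{(2N+1)})(0)>0$, and $\gamma$ is oriented compatibly. Then, with a suitable parameter and any $k\in\mathbb{N}$ (with $k\ge 3$), $$\gamma(t)=\Big(t,\ \sum_{i=2}^k\frac{a_i}{i!}t^i,\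 \sum_{i=3}^k\frac{b_i}{i!}t^i\Big)+(O(k+1),O(k+1),O(k+1)),\qquad a_2>0,\ b_3\ge0,$$ where $O(k+1)$ denotes terms of degree greater than $k$. The number $\mu$ is computed for $\gamma_{\xi_1}$ as a curve in the $yz$-plane. The plane $\xi_2^\perp$ is oriented so that a basis $\{X,Y\}$ is positive iff $\{X,Y,\xi_2\}$ is a positive basis of $\mathbb{R}^3$; $\gamma_{\xi_2}$ carries the orientation of $\gamma$, is parametrized by arc-length $s$ with $s=0$ at $t=0$, and $\kappa_{\xi_2}$ is its signed curvature; explicitly $\kappa_{\xi_2}=\det(\gamma',\gamma'',\xi_2)/|\gamma_{\xi_2}'|^3$. The $k$-th order information of a $C^\infty$ function $\psi$ at $0$ is $(\psi(0),\psi'(0),\psi''(0)/2,\ldots,\psi^{(k)}(0)/k!)$; for $\kappa_{\xi_2}$ derivatives are with respect to $s$. "Uniquely determined by given data" means: for fixed (known) $\theta_1,\theta_2$ with $\cos\theta_1\neq0$, two curves $\gamma,\tilde\gamma$ with the same data have the same value of the quantity in question. Here each of $\gamma,\tilde\gamma$ is a regular $C^\infty$ curve through the origin at $t=0$ with non-zero curvature at $0$, written near $0$ as $\big(t,\ \sum_{i=2}^k\frac{a_i}{i!}t^i,\ \sum_{i=3}^k\frac{b_i}{i!}t^i\big)+(O(k+1),O(k+1),O(k+1))$ with its own coefficients satisfying $a_2>0$, $b_3\ge0$, and such that its projection $c$ in the direction $\xi_1=(1,0,0)$ satisfies, for some integer $N$, $\det(c'',c^{(i)})(0)=0$ for $i=3,5,\ldots,2N-1$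 and $\det(c'',c^{(2N+1)})(0)>0$. *)

theory Defs
  imports "HOL-Analysis.Analysis" "HOL-Library.Landau_Symbols"
begin

definition vderiv :: "nat \<Rightarrow> (real \<Rightarrow> 'a::real_normed_vector) \<Rightarrow> real \<Rightarrow> 'a" where
  "vderiv n c = ((\<lambda>g t. vector_derivative g (at t)) ^^ n) c"

text \<open>\<open>C\<^sup>\<infinity>\<close> on an open set of parameters.\<close>

definition smooth_on :: "real set \<Rightarrow> (real \<Rightarrow> 'a::real_normed_vector) \<Rightarrow> bool" where
  "smooth_on I c \<longleftrightarrow> (\<forall>n. \<forall>t\<in>I. vderiv n c differentiable (at t))"

definition det2 :: "real^2 \<Rightarrow> real^2 \<Rightarrow> real" where
  "det2 u v = det (vector [u, v] :: real^2^2)"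

definition det3 :: "real^3 \<Rightarrow> real^3 \<Rightarrow> real^3 \<Rightarrow> real" where
  "det3 u v w = det (vector [u, v, w] :: real^3^3)"

text \<open>For a unit vector \<open>\<xi>\<close>, the orthogonal projection onto the plane orthogonal to \<open>\<xi>\<close>,
  which is kept as a subspace of \<open>\<real>\<^sup>3\<close>.\<close>

definition proj :: "real^3 \<Rightarrow> real^3 \<Rightarrow> real^3" where
  "proj \<xi> x = x - (x \<bullet> \<xi>) *\<^sub>R \<xi>"

definition proj_curve :: "real^3 \<Rightarrow> (real \<Rightarrow> real^3) \<Rightarrow> real \<Rightarrow> real^3" where
  "proj_curve \<xi> \<gamma> = proj \<xi> \<circ> \<gamma>"

text \<open>The coordinates \<open>yz\<close> on the plane orthogonal to \<open>(1,0,0)\<close>.\<close>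

definition yz :: "real^3 \<Rightarrow> real^2" where
  "yz x = vector [x $ 2, x $ 3]"

definition space_curvature :: "(real \<Rightarrow> real^3) \<Rightarrow> real \<Rightarrow> real" where
  "space_curvature \<gamma> t = norm (cross3 (vderiv 1 \<gamma> t) (vderiv 2 \<gamma> t)) / norm (vderiv 1 \<gamma> t) ^ 3"

text \<open>Meaningful for plane curves with \<open>c'(0) = 0\<close> and \<open>c''(0) \<noteq> 0\<close>.\<close>

definition cuspidal_curvature :: "(real \<Rightarrow> real^2) \<Rightarrow> real" where
  "cuspidal_curvature c = det2 (vderiv 2 c 0) (vderiv 3 c 0) / norm (vderiv 2 c 0) powr (5/2)"

text \<open>Signed curvature of a curve \<open>c\<close> in the plane orthogonal to the unit vector \<open>\<xi>\<close>, oriented so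
  that \<open>{X, Y}\<close> is positive iff \<open>{X, Y, \<xi>}\<close> is a positive basis of \<open>\<real>\<^sup>3\<close>; the area form of that
  oriented plane is \<open>\<lambda>X Y. det3 X Y \<xi>\<close>.\<close>

definition signed_curvature :: "real^3 \<Rightarrow> (real \<Rightarrow> real^3) \<Rightarrow> real \<Rightarrow> real" where
  "signed_curvature \<xi> c t = det3 (vderiv 1 c t) (vderiv 2 c t) \<xi> / norm (vderiv 1 c t) ^ 3"

text \<open>Arc length measured from \<open>t = 0\<close>, negative for \<open>t < 0\<close>.\<close>

definition arc_length :: "(real \<Rightarrow> 'a::real_normed_vector) \<Rightarrow> real \<Rightarrow> real" where
  "arc_length c t = (LBINT u = ereal 0..ereal t. norm (vderiv 1 c u))"

text \<open>The signed curvature as a function of the arc-length parameter \<open>s\<close>. On an interval \<open>I\<close> the arc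
  length is nondecreasing, and strictly increasing near \<open>0\<close> if \<open>c'(0) \<noteq> 0\<close>. Hence every \<open>s\<close> close
  to \<open>0\<close> is the arc length of exactly one \<open>t \<in> I\<close>, and \<open>the_inv_into\<close> yields that \<open>t\<close>, even
  when \<open>c\<close> is not regular on all of \<open>I\<close>.\<close>

definition arc_length_curvature ::
    "real set \<Rightarrow> real^3 \<Rightarrow> (real \<Rightarrow> real^3) \<Rightarrow> real \<Rightarrow> real" where
  "arc_length_curvature I \<xi> c s = signed_curvature \<xi> c (the_inv_into I (arc_length c) s)"

text \<open>The \<open>k\<close>-th order information of \<open>\<psi>\<close> at \<open>0\<close>.\<close>

definition order_info :: "nat \<Rightarrow> (real \<Rightarrow> real) \<Rightarrow> real list" where
  "order_info k \<psi> = map (\<lambda>i. (deriv ^^ i) \<psi> 0 / fact i) [0..<Suc k]"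

text \<open>A regular smooth space curve on an open interval around \<open>0\<close>, through the origin, with
  non-zero curvature there.\<close>

definition admissible_curve :: "real set \<Rightarrow> (real \<Rightarrow> real^3) \<Rightarrow> bool" where
  "admissible_curve I \<gamma> \<longleftrightarrow>
     open I \<and> is_interval I \<and> 0 \<in> I \<and>
     smooth_on I \<gamma> \<and> (\<forall>t\<in>I. vderiv 1 \<gamma> t \<noteq> 0) \<and>
     \<gamma> 0 = 0 \<and> space_curvature \<gamma> 0 \<noteq> 0"

text \<open>The expansion up to terms of degree greater than \<open>k\<close>. Only \<open>a i\<close> with \<open>2 \<le> i \<le> k\<close> and
  \<open>b i\<close> with \<open>3 \<le> i \<le> k\<close> matter.\<close>

definition normal_form ::
    "nat \<Rightarrow> (nat \<Rightarrow> real) \<Rightarrow> (nat \<Rightarrow> real) \<Rightarrow> (real \<Rightarrow> real^3) \<Rightarrow> bool" where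
  "normal_form k a b \<gamma> \<longleftrightarrow>
     (\<lambda>t. \<gamma> t $ 1 - t) \<in> O[at 0](\<lambda>t. t ^ (k + 1)) \<and>
     (\<lambda>t. \<gamma> t $ 2 - (\<Sum>i=2..k. a i / fact i * t ^ i)) \<in> O[at 0](\<lambda>t. t ^ (k + 1)) \<and>
     (\<lambda>t. \<gamma> t $ 3 - (\<Sum>i=3..k. b i / fact i * t ^ i)) \<in> O[at 0](\<lambda>t. t ^ (k + 1)) \<and>
     a 2 > 0 \<and> b 3 \<ge> 0"

definition oriented_cusp :: "(real \<Rightarrow> real^2) \<Rightarrow> bool" where
  "oriented_cusp c \<longleftrightarrow>
     (\<exists>N\<ge>1. (\<forall>i. odd i \<and> 3 \<le> i \<and> i \<le> 2 * N - 1 \<longrightarrow> det2 (vderiv 2 c 0) (vderiv i c 0) = 0) \<and>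
            det2 (vderiv 2 c 0) (vderiv (2 * N + 1) c 0) > 0)"

end

theory Submission
  imports Defs
begin

text \<open>
  In normal form the derivatives of \<open>\<gamma>\<close> at \<open>0\<close> are \<open>\<gamma>' = (1, 0, 0)\<close>, \<open>\<gamma>'' = (0, a\<^sub>2, 0)\<close> and
  \<open>\<gamma>''' = (0, a\<^sub>3, b\<^sub>3)\<close> (\<open>normal_form_vderiv\<close>), because Taylor coefficients are unique. Let
  \<open>v\<close> be the length of the projection of \<open>(1, 0, 0)\<close> along \<open>\<xi>\<^sub>2\<close>; it depends only on the known
  angles and is positive because \<open>cos \<theta>\<^sub>1 \<noteq> 0\<close>. The data are then explicit functions of the
  coefficients:

  \<^item> \<open>\<mu> = a\<^sub>2 b\<^sub>3 / a\<^sub>2\<^bsup>5/2\<^esup>\<close> (\<open>normal_form_cuspidal_curvature\<close>);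
  \<^item> \<open>\<kappa>(0) = a\<^sub>2 cos \<theta>\<^sub>1 / v\<^sup>3\<close>;
  \<^item> \<open>\<kappa>'(0) = ((a\<^sub>3 cos \<theta>\<^sub>1 - b\<^sub>3 sin \<theta>\<^sub>1 sin \<theta>\<^sub>2) / v\<^sup>3 - Q(a\<^sub>2)) / v\<close>, where \<open>Q\<close> is a function
    that depends only on the angles (both from \<open>projected_curvature_order_1\<close>).

  Since \<open>cos \<theta>\<^sub>1 \<noteq> 0\<close>, these can be solved one after the other: \<open>\<kappa>(0)\<close> gives \<open>a\<^sub>2\<close>, then \<open>\<mu>\<close> gives
  \<open>b\<^sub>3\<close>, then \<open>\<kappa>'(0)\<close> gives \<open>a\<^sub>3\<close>.

  The analytic content of the formula for \<open>\<kappa>'(0)\<close> is that the arc length of the projected curve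
  has a differentiable inverse at \<open>0\<close> (\<open>the_inv_into_arc_length_derivative\<close>), even though the
  projected curve may have singular points elsewhere on the parameter interval.
\<close>

section \<open>Iterated derivatives\<close>

lemma vderiv_Suc: "vderiv (Suc n) c t = vector_derivative (vderiv n c) (at t)"
  by (simp add: vderiv_def)

lemma vderiv_0 [simp]: "vderiv 0 c = c"
  by (simp add: vderiv_def)

lemma smooth_on_has_vector_derivative:
  assumes "smooth_on I c" "t \<in> I"
  shows "(vderiv n c has_vector_derivative vderiv (Suc n) c t) (at t)"
  using assms unfolding smooth_on_def vderiv_Suc by (simp add: vector_derivative_works[symmetric])

lemma vderiv_bounded_linear:
  assumes "open I" "smooth_on I c" "bounded_linear L" "t \<in> I"
  shows "vderiv n (L \<circ> c) t = L (vderiv n c t)"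
  using \<open>t \<in> I\<close>
proof (induction n arbitrary: t)
  case (Suc n)
  have "((\<lambda>s. L (vderiv n c s)) has_vector_derivative L (vderiv (Suc n) c t)) (at t)"
    using bounded_linear.has_vector_derivative[OF \<open>bounded_linear L\<close>]
      smooth_on_has_vector_derivative[OF assms(2) Suc.prems] by blast
  then have "(vderiv n (L \<circ> c) has_vector_derivative L (vderiv (Suc n) c t)) (at t)"
    by (rule has_vector_derivative_transform_within_open[OF _ \<open>open I\<close> Suc.prems])
      (simp add: Suc.IH)
  then show ?case
    unfolding vderiv_Suc[of n "L \<circ> c"] by (rule vector_derivative_at)
qed simp

lemma smooth_on_bounded_linear:
  assumes "open I" "smooth_on I c" "bounded_linear L"
  shows "smooth_on I (L \<circ> c)"
  unfolding smooth_on_def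
proof (intro allI ballI)
  fix n t assume t: "t \<in> I"
  have "((\<lambda>s. L (vderiv n c s)) has_vector_derivative L (vderiv (Suc n) c t)) (at t)"
    using bounded_linear.has_vector_derivative[OF \<open>bounded_linear L\<close>]
      smooth_on_has_vector_derivative[OF assms(2) t] by blast
  then have "(vderiv n (L \<circ> c) has_vector_derivative L (vderiv (Suc n) c t)) (at t)"
    by (rule has_vector_derivative_transform_within_open[OF _ \<open>open I\<close> t])
      (simp add: vderiv_bounded_linear[OF assms])
  then show "vderiv n (L \<circ> c) differentiable (at t)"
    by (rule differentiableI_vector)
qed

section \<open>Taylor coefficients\<close>

text \<open>The bound tends to \<open>0\<close> as \<open>t \<rightarrow> 0\<close>, so the constant coefficient vanishes; dividing
  by \<open>t\<close> leaves a polynomial of one degree less with a bound of one order less, to which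
  induction applies.\<close>

lemma polynomial_bigo_imp_coeff_eq_0:
  fixes d :: "nat \<Rightarrow> real"
  assumes "(\<lambda>t. \<Sum>i\<le>n. d i * t ^ i) \<in> O[at 0](\<lambda>t. t ^ Suc n)" "i \<le> n"
  shows "d i = 0"
  using assms
proof (induction n arbitrary: d i)
  case 0
  then obtain C where "eventually (\<lambda>t. \<bar>d 0\<bar> \<le> C * \<bar>t\<bar>) (at 0)"
    by (auto elim!: landau_o.bigE)
  moreover have "((\<lambda>t. C * \<bar>t\<bar>) \<longlongrightarrow> C * \<bar>0::real\<bar>) (at 0)"
    by (intro tendsto_intros)
  ultimately have "\<bar>d 0\<bar> \<le> C * \<bar>0::real\<bar>"
    by (intro tendsto_le[OF _ _ tendsto_const]) auto
  with 0 show ?case by simp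
next
  case (Suc n)
  let ?p = "\<lambda>t. \<Sum>i\<le>Suc n. d i * t ^ i"
  from Suc.prems(1) obtain C where C: "eventually (\<lambda>t. norm (?p t) \<le> C * norm (t ^ Suc (Suc n))) (at 0)"
    by (auto elim!: landau_o.bigE)
  have "((\<lambda>t::real. C * norm (t ^ Suc (Suc n))) \<longlongrightarrow> C * norm ((0::real) ^ Suc (Suc n))) (at 0)"
    by (intro tendsto_intros)
  moreover have "((\<lambda>t. norm (?p t)) \<longlongrightarrow> norm (?p 0)) (at 0)"
    by (intro tendsto_intros)
  ultimately have "norm (?p 0) \<le> C * norm ((0::real) ^ Suc (Suc n))"
    using C by (intro tendsto_le[OF _ _ _ C]) auto
  then have d0: "d 0 = 0"
    by (simp add: sum.atMost_Suc_shift del: sum.atMost_Suc)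
  have p: "?p t = t * (\<Sum>i\<le>n. d (Suc i) * t ^ i)" for t
    unfolding sum.atMost_Suc_shift by (simp add: d0 sum_distrib_left mult_ac)
  have "(\<lambda>t. \<Sum>i\<le>n. d (Suc i) * t ^ i) \<in> O[at 0](\<lambda>t. t ^ Suc n)"
  proof (rule landau_o.bigI[of "max C 1"])
    show "eventually (\<lambda>t. norm (\<Sum>i\<le>n. d (Suc i) * t ^ i) \<le> max C 1 * norm (t ^ Suc n)) (at 0)"
      using C eventually_neq_at_within[of "0::real" 0 UNIV]
    proof eventually_elim
      case (elim t)
      have "\<bar>t\<bar> * norm (\<Sum>i\<le>n. d (Suc i) * t ^ i) \<le> \<bar>t\<bar> * (C * norm (t ^ Suc n))"
        using elim(1) unfolding p by (simp add: abs_mult mult_ac)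
      then have "norm (\<Sum>i\<le>n. d (Suc i) * t ^ i) \<le> C * norm (t ^ Suc n)"
        by (rule mult_left_le_imp_le) (use elim(2) in simp)
      also have "\<dots> \<le> max C 1 * norm (t ^ Suc n)"
        by (intro mult_right_mono) auto
      finally show ?case .
    qed
  qed auto
  from Suc.IH[OF this] d0 Suc.prems(2) show ?case
    by (cases i) auto
qed

text \<open>The Lagrange remainder is \<open>f\<^bsup>(n+1)\<^esup>(\<tau>) t\<^bsup>n+1\<^esup> / (n+1)!\<close>, and the continuous function
  \<open>f\<^bsup>(n+1)\<^esup>\<close> is bounded on a compact neighbourhood of \<open>0\<close>.\<close>

lemma smooth_on_taylor_bigo:
  fixes f :: "real \<Rightarrow> real"
  assumes "open I" "0 \<in> I" "smooth_on I f"
  shows "(\<lambda>t. f t - (\<Sum>i\<le>n. vderiv i f 0 / fact i * t ^ i)) \<in> O[at 0](\<lambda>t. t ^ Suc n)"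
proof -
  obtain e where e: "e > 0" "cball 0 e \<subseteq> I"
    using assms open_contains_cball by blast
  have "continuous_on (cball 0 e) (vderiv (Suc n) f)"
    using e assms(3) unfolding smooth_on_def
    by (intro differentiable_imp_continuous_on differentiable_at_imp_differentiable_on) auto
  then have "bounded (vderiv (Suc n) f ` cball 0 e)"
    by (intro compact_imp_bounded compact_continuous_image) auto
  then obtain B where B: "B > 0" "\<And>t. t \<in> cball 0 e \<Longrightarrow> norm (vderiv (Suc n) f t) \<le> B"
    by (auto simp: bounded_pos)
  show ?thesis
  proof (rule landau_o.bigI[of "B / fact (Suc n)"])
    show "eventually (\<lambda>t. norm (f t - (\<Sum>i\<le>n. vderiv i f 0 / fact i * t ^ i))
            \<le> B / fact (Suc n) * norm (t ^ Suc n)) (at 0)"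
      unfolding eventually_at
    proof (intro exI[of _ e] conjI ballI impI)
      fix x :: real assume "x \<noteq> 0 \<and> dist x 0 < e"
      then have x: "\<bar>x\<bar> < e" by simp
      have "\<exists>t. \<bar>t\<bar> \<le> \<bar>x\<bar> \<and> f x = (\<Sum>m<Suc n. vderiv m f 0 / fact m * x ^ m)
              + vderiv (Suc n) f t / fact (Suc n) * x ^ Suc n"
        using x e smooth_on_has_vector_derivative[OF assms(3)]
        by (intro Maclaurin_bi_le)
          (auto simp: has_real_derivative_iff_has_vector_derivative subset_iff)
      then obtain t where t: "\<bar>t\<bar> \<le> \<bar>x\<bar>" "f x = (\<Sum>m<Suc n. vderiv m f 0 / fact m * x ^ m)
              + vderiv (Suc n) f t / fact (Suc n) * x ^ Suc n" by blast
      have "norm (f x - (\<Sum>i\<le>n. vderiv i f 0 / fact i * x ^ i))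
          = norm (vderiv (Suc n) f t) / fact (Suc n) * norm (x ^ Suc n)"
        unfolding t(2) lessThan_Suc_atMost by (simp add: abs_mult)
      also have "\<dots> \<le> B / fact (Suc n) * norm (x ^ Suc n)"
        using x t(1) by (intro mult_right_mono divide_right_mono B(2)) auto
      finally show "norm (f x - (\<Sum>i\<le>n. vderiv i f 0 / fact i * x ^ i))
          \<le> B / fact (Suc n) * norm (x ^ Suc n)" .
    qed (use e in auto)
  qed (use B in simp)
qed

text \<open>Two expansions of the same function to order \<open>n\<close> differ by a polynomial of degree at most
  \<open>n\<close> that is \<open>O(t\<^bsup>n+1\<^esup>)\<close>. Hence any such expansion is the Taylor expansion, and the
  coefficients in a normal form can be read as derivatives.\<close>

lemma smooth_on_expansion_imp_vderiv_eq:
  fixes f :: "real \<Rightarrow> real"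
  assumes "open I" "0 \<in> I" "smooth_on I f"
    and "(\<lambda>t. f t - (\<Sum>i\<le>n. c i / fact i * t ^ i)) \<in> O[at 0](\<lambda>t. t ^ Suc n)" "m \<le> n"
  shows "vderiv m f 0 = c m"
proof -
  have "(\<lambda>t. (f t - (\<Sum>i\<le>n. c i / fact i * t ^ i)) - (f t - (\<Sum>i\<le>n. vderiv i f 0 / fact i * t ^ i)))
      \<in> O[at 0](\<lambda>t. t ^ Suc n)"
    by (rule sum_in_bigo(2)[OF assms(4) smooth_on_taylor_bigo[OF assms(1-3)]])
  also have "(\<lambda>t. (f t - (\<Sum>i\<le>n. c i / fact i * t ^ i)) - (f t - (\<Sum>i\<le>n. vderiv i f 0 / fact i * t ^ i)))
     = (\<lambda>t. \<Sum>i\<le>n. (vderiv i f 0 - c i) / fact i * t ^ i)"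
    by (simp add: fun_eq_iff sum_subtractf[symmetric] algebra_simps diff_divide_distrib)
  finally have "(vderiv m f 0 - c m) / fact m = 0"
    by (rule polynomial_bigo_imp_coeff_eq_0) (rule assms(5))
  then show ?thesis by simp
qed

lemma normal_form_vderiv:
  assumes "k \<ge> 3" "admissible_curve I \<gamma>" "normal_form k a b \<gamma>"
  shows "vderiv 1 \<gamma> 0 = vector [1, 0, 0]"
    and "vderiv 2 \<gamma> 0 = vector [0, a 2, 0]"
    and "vderiv 3 \<gamma> 0 = vector [0, a 3, b 3]"
proof -
  have I: "open I" "0 \<in> I" "smooth_on I \<gamma>"
    using assms(2) by (auto simp: admissible_curve_def)
  have comp: "vderiv m \<gamma> 0 $ j = c m"
    if "(\<lambda>t. \<gamma> t $ j - (\<Sum>i\<le>k. c i / fact i * t ^ i)) \<in> O[at 0](\<lambda>t. t ^ Suc k)" "m \<le> k"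
    for c m and j :: 3
  proof -
    have L: "bounded_linear (\<lambda>x::real^3. x $ j)" by (rule bounded_linear_vec_nth)
    have "vderiv m ((\<lambda>x. x $ j) \<circ> \<gamma>) 0 = c m"
      using smooth_on_expansion_imp_vderiv_eq[OF I(1,2) smooth_on_bounded_linear[OF I(1,3) L]] that
      by simp
    then show ?thesis
      using vderiv_bounded_linear[OF I(1,3) L I(2)] by simp
  qed
  \<comment> \<open>The three expansions as sums over all \<open>i \<le> k\<close>, padded with zero coefficients.\<close>
  have sums: "(\<Sum>i\<le>k. (if i = 1 then 1 else 0) / fact i * t ^ i) = t"
    "(\<Sum>i\<le>k. (if m \<le> i then c i else 0) / fact i * t ^ i) = (\<Sum>i=m..k. c i / fact i * t ^ i)"
    for t :: real and c m
  proof -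
    have "(\<Sum>i\<le>k. (if i = 1 then 1 else 0) / fact i * t ^ i) = (\<Sum>i\<le>k. if i = 1 then t else 0)"
      by (intro sum.cong) auto
    then show "(\<Sum>i\<le>k. (if i = 1 then 1 else 0) / fact i * t ^ i) = t"
      using assms(1) by simp
    show "(\<Sum>i\<le>k. (if m \<le> i then c i else 0) / fact i * t ^ i) = (\<Sum>i=m..k. c i / fact i * t ^ i)"
      by (rule sum.mono_neutral_cong_right) auto
  qed
  have c1: "vderiv m \<gamma> 0 $ 1 = (if m = 1 then 1 else 0)" if "m \<le> k" for m
    using assms(3) that by (intro comp) (simp_all only: sums normal_form_def Suc_eq_plus1)
  have c2: "vderiv m \<gamma> 0 $ 2 = (if 2 \<le> m then a m else 0)" if "m \<le> k" for m
    using assms(3) that by (intro comp) (simp_all only: sums normal_form_def Suc_eq_plus1)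
  have c3: "vderiv m \<gamma> 0 $ 3 = (if 3 \<le> m then b m else 0)" if "m \<le> k" for m
    using assms(3) that by (intro comp) (simp_all only: sums normal_form_def Suc_eq_plus1)
  show "vderiv 1 \<gamma> 0 = vector [1, 0, 0]" "vderiv 2 \<gamma> 0 = vector [0, a 2, 0]"
    "vderiv 3 \<gamma> 0 = vector [0, a 3, b 3]"
    using assms(1) by (simp_all add: vec_eq_iff forall_3 c1 c2 c3)
qed

section \<open>Arc length\<close>

text \<open>The fundamental theorem of calculus is applied on a compact interval inside \<open>I\<close> whose
  interior contains both \<open>0\<close> and \<open>t\<close>, so that the derivative within the interval is a derivative
  proper.\<close>

lemma has_real_derivative_arc_length:
  fixes c :: "real \<Rightarrow> 'a::real_normed_vector"
  assumes "open I" "is_interval I" "0 \<in> I" "continuous_on I (vderiv 1 c)" "t \<in> I"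
  shows "(arc_length c has_real_derivative norm (vderiv 1 c t)) (at t)"
proof -
  have "min 0 t \<in> I" "max 0 t \<in> I" using assms by (auto simp: min_def max_def)
  then obtain e1 e2 where e: "e1 > 0" "cball (min 0 t) e1 \<subseteq> I" "e2 > 0" "cball (max 0 t) e2 \<subseteq> I"
    using \<open>open I\<close> open_contains_cball by meson
  define p q where "p = min 0 t - e1" and "q = max 0 t + e2"
  have pq: "p < 0" "p < t" "0 < q" "t < q" using e by (auto simp: p_def q_def)
  have "p \<in> I" "q \<in> I"
    using e by (auto simp: p_def q_def subset_iff dist_real_def)
  then have sub: "{p..q} \<subseteq> I"
    using \<open>is_interval I\<close> unfolding is_interval_1 by (meson atLeastAtMost_iff subsetI)
  have "continuous_on {p..q} (\<lambda>u. norm (vderiv 1 c u))"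
    using assms(4) sub by (intro continuous_on_norm) (rule continuous_on_subset)
  then have "((\<lambda>u. LBINT y=ereal 0..ereal u. norm (vderiv 1 c y)) has_vector_derivative norm (vderiv 1 c t))
        (at t within {p..q})"
    using pq by (intro interval_integral_FTC2) auto
  then have "((\<lambda>u. LBINT y=ereal 0..ereal u. norm (vderiv 1 c y)) has_vector_derivative norm (vderiv 1 c t)) (at t)"
    using pq by (simp add: at_within_Icc_at)
  then show ?thesis
    by (simp add: arc_length_def[abs_def] has_real_derivative_iff_has_vector_derivative)
qed

text \<open>The speed of \<open>c\<close> may vanish away from \<open>0\<close>, so the arc length need not be injective on \<open>I\<close>.
  But it is nondecreasing on \<open>I\<close> and strictly increasing near \<open>0\<close>, so a value taken near \<open>0\<close>
  is taken at no other parameter of \<open>I\<close>. This suffices for \<open>the_inv_into\<close>, defined by a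
  unique description, to invert the arc length near \<open>0\<close>.\<close>

lemma arc_length_inverse_local:
  fixes c :: "real \<Rightarrow> 'a::real_normed_vector"
  assumes "open I" "is_interval I" "0 \<in> I" "continuous_on I (vderiv 1 c)" "vderiv 1 c 0 \<noteq> 0"
  obtains e where "e > 0" "ball 0 e \<subseteq> I"
    "\<And>t. t \<in> ball 0 e \<Longrightarrow> the_inv_into I (arc_length c) (arc_length c t) = t"
proof -
  let ?\<sigma> = "arc_length c"
  have "open (I \<inter> vderiv 1 c -` (- {0}))"
    by (rule continuous_open_preimage[OF assms(4,1)]) auto
  moreover have "0 \<in> I \<inter> vderiv 1 c -` (- {0})" using assms by simp
  ultimately obtain e where e: "e > 0" "ball 0 e \<subseteq> I \<inter> vderiv 1 c -` (- {0})"
    using open_contains_ball by meson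
  note D = has_real_derivative_arc_length[OF assms(1-4)]
  have mono: "?\<sigma> x \<le> ?\<sigma> y" if "x \<in> I" "y \<in> I" "x \<le> y" for x y
    using that \<open>is_interval I\<close> D
    by (intro DERIV_nonneg_imp_nondecreasing[OF \<open>x \<le> y\<close>]) (metis is_interval_1 norm_ge_zero)
  have smono: "?\<sigma> x < ?\<sigma> y" if "x \<in> ball 0 e" "y \<in> ball 0 e" "x < y" for x y
  proof (rule DERIV_pos_imp_increasing[OF \<open>x < y\<close>])
    fix z assume "x \<le> z" "z \<le> y"
    then have "z \<in> ball 0 e" using that by (auto simp: dist_real_def)
    then have "z \<in> I" "vderiv 1 c z \<noteq> 0" using e by auto
    then show "\<exists>d. (?\<sigma> has_real_derivative d) (at z) \<and> 0 < d"
      using D[of z] by auto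
  qed
  have uniq: "x = t" if "t \<in> ball 0 e" "x \<in> I" "?\<sigma> x = ?\<sigma> t" for t x
  proof (rule ccontr)
    assume "x \<noteq> t"
    then consider "x < t" | "t < x" by linarith
    then show False
    proof cases
      case 1
      \<comment> \<open>A point between the two parameters that is still within \<open>e\<close> of \<open>0\<close>: going from \<open>x\<close>
        to \<open>m\<close> the arc length does not decrease, and from \<open>m\<close> to \<open>t\<close> it strictly grows.\<close>
      define m where "m = max x ((t - e) / 2)"
      have m: "m \<in> ball 0 e" "m < t" "x \<le> m"
        using that 1 by (auto simp: m_def dist_real_def max_def)
      then have "?\<sigma> x \<le> ?\<sigma> m" "?\<sigma> m < ?\<sigma> t"
        using that e mono[of x m] smono[of m t] by blast+
      with that show False by simp
    next
      case 2
      define m where "m = min x ((t + e) / 2)"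
      have m: "m \<in> ball 0 e" "t < m" "m \<le> x"
        using that 2 by (auto simp: m_def dist_real_def min_def)
      then have "?\<sigma> m \<le> ?\<sigma> x" "?\<sigma> t < ?\<sigma> m"
        using that e mono[of m x] smono[of t m] by blast+
      with that show False by simp
    qed
  qed
  show ?thesis
  proof (rule that[OF \<open>e > 0\<close>])
    show "ball 0 e \<subseteq> I" using e by auto
    show "the_inv_into I ?\<sigma> (?\<sigma> t) = t" if "t \<in> ball 0 e" for t
      unfolding the_inv_into_def using that e uniq by (intro the_equality) auto
  qed
qed

lemma arc_length_at_0 [simp]: "arc_length c 0 = 0"
  by (simp add: arc_length_def interval_integral_endpoints_same)

lemma the_inv_into_arc_length_derivative:
  fixes c :: "real \<Rightarrow> 'a::real_normed_vector"
  assumes "open I" "is_interval I" "0 \<in> I" "continuous_on I (vderiv 1 c)" "vderiv 1 c 0 \<noteq> 0"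
  shows "the_inv_into I (arc_length c) 0 = 0"
    and "(the_inv_into I (arc_length c) has_real_derivative inverse (norm (vderiv 1 c 0))) (at 0)"
proof -
  obtain e where e: "e > 0" "ball 0 e \<subseteq> I"
    "\<And>t. t \<in> ball 0 e \<Longrightarrow> the_inv_into I (arc_length c) (arc_length c t) = t"
    using arc_length_inverse_local[OF assms] by blast
  show "the_inv_into I (arc_length c) 0 = 0"
    using e(3)[of 0] e(1) by simp
  note D = has_real_derivative_arc_length[OF assms(1-4)]
  have cont: "continuous_on (ball 0 e) (arc_length c)"
    using D e(2) by (intro continuous_at_imp_continuous_on) (auto intro: DERIV_isCont)
  have "(the_inv_into I (arc_length c) has_derivative (*) (inverse (norm (vderiv 1 c 0))))
      (at (arc_length c 0))"
  proof (rule has_derivative_inverse_strong[where S = "ball 0 e" and x = 0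
        and f' = "(*) (norm (vderiv 1 c 0))"])
    show "(arc_length c has_derivative (*) (norm (vderiv 1 c 0))) (at 0)"
      using D[OF assms(3)] by (simp add: has_field_derivative_def)
    show "(*) (norm (vderiv 1 c 0)) \<circ> (*) (inverse (norm (vderiv 1 c 0))) = id"
      using assms(5) by (simp add: fun_eq_iff)
  qed (use e cont in simp_all)
  then show "(the_inv_into I (arc_length c) has_real_derivative inverse (norm (vderiv 1 c 0))) (at 0)"
    by (simp add: has_field_derivative_def)
qed

section \<open>Curvature of the projections\<close>

lemma bounded_bilinear_det3: "bounded_bilinear (\<lambda>X Y. det3 X Y \<xi>)"
  unfolding bilinear_conv_bounded_bilinear[symmetric]
  by (simp add: bilinear_def linear_iff det3_def det_3 algebra_simps)

text \<open>Projecting along \<open>\<xi>\<close> changes \<open>X\<close> and \<open>Y\<close> by multiples of \<open>\<xi>\<close>, which is also the last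
  row of the determinant.\<close>

lemma det3_proj: "det3 (proj \<xi> X) (proj \<xi> Y) \<xi> = det3 X Y \<xi>"
  by (simp add: det3_def proj_def det_3 algebra_simps)

lemma bounded_linear_proj: "bounded_linear (proj \<xi>)"
  unfolding proj_def
  by (intro bounded_linear_sub bounded_linear_ident bounded_linear_scaleR_const bounded_linear_inner_left)

lemma bounded_linear_yz: "bounded_linear yz"
  unfolding linear_conv_bounded_linear[symmetric]
  by (simp add: linear_iff yz_def vec_eq_iff forall_2)

text \<open>The derivative of \<open>det3 c' c'' \<xi> / |c'|\<^sup>3\<close> with respect to the parameter of \<open>c\<close>, where \<open>x\<close>,
  \<open>y\<close>, \<open>z\<close> stand for \<open>c'\<close>, \<open>c''\<close>, \<open>c'''\<close>; it is affine in the third derivative.\<close>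

definition curvature_rate :: "real^3 \<Rightarrow> real^3 \<Rightarrow> real^3 \<Rightarrow> real^3 \<Rightarrow> real" where
  "curvature_rate \<xi> x y z =
     det3 x z \<xi> / norm x ^ 3 - 3 * det3 x y \<xi> * (y \<bullet> sgn x) / norm x ^ 4"

text \<open>In the derivative of the numerator the term \<open>det3 c'' c'' \<xi>\<close> vanishes, and the speed
  has derivative \<open>c'' \<bullet> sgn c'\<close>.\<close>

lemma signed_curvature_derivative:
  assumes "smooth_on I c" "t \<in> I" "vderiv 1 c t \<noteq> 0"
  shows "(signed_curvature \<xi> c has_real_derivative
      curvature_rate \<xi> (vderiv 1 c t) (vderiv 2 c t) (vderiv 3 c t)) (at t)"
proof -
  let ?x = "vderiv 1 c t" and ?y = "vderiv 2 c t" and ?z = "vderiv 3 c t"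
  have d1: "(vderiv 1 c has_vector_derivative ?y) (at t)"
    and d2: "(vderiv 2 c has_vector_derivative ?z) (at t)"
    using smooth_on_has_vector_derivative[OF assms(1,2), of 1] smooth_on_has_vector_derivative[OF assms(1,2), of 2]
    by (simp_all add: numeral_2_eq_2 numeral_3_eq_3)
  have "det3 ?y ?y \<xi> = 0" by (simp add: det3_def det_3 algebra_simps)
  then have num: "((\<lambda>t. det3 (vderiv 1 c t) (vderiv 2 c t) \<xi>) has_real_derivative det3 ?x ?z \<xi>) (at t)"
    using bounded_bilinear.has_vector_derivative[OF bounded_bilinear_det3 d1 d2, of \<xi>]
    by (simp add: has_real_derivative_iff_has_vector_derivative)
  have "((\<lambda>t. norm (vderiv 1 c t)) has_derivative (\<lambda>h. (h *\<^sub>R ?y) \<bullet> sgn ?x)) (at t)"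
    using has_derivative_compose[OF d1[unfolded has_vector_derivative_def] has_derivative_norm[OF assms(3)]]
    by simp
  then have "((\<lambda>t. norm (vderiv 1 c t)) has_real_derivative ?y \<bullet> sgn ?x) (at t)"
    unfolding has_field_derivative_def by (rule has_derivative_eq_rhs) (simp add: fun_eq_iff)
  note DERIV_divide[OF num DERIV_power[OF this, of 3]]
  moreover have "(det3 ?x ?z \<xi> * norm ?x ^ 3 - det3 ?x ?y \<xi> * (of_nat 3 * ((?y \<bullet> sgn ?x) * norm ?x ^ (3 - Suc 0))))
       / (norm ?x ^ 3 * norm ?x ^ 3) = curvature_rate \<xi> ?x ?y ?z"
    using assms(3) unfolding curvature_rate_def
    by (simp add: field_simps eval_nat_numeral)
  ultimately show ?thesis
    using assms(3) by (simp add: signed_curvature_def[abs_def])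
qed

text \<open>The chain rule with the inverse of the arc length, whose derivative at \<open>0\<close> is the
  reciprocal of the speed.\<close>

lemma arc_length_curvature_order_1:
  fixes c :: "real \<Rightarrow> real^3"
  assumes "open I" "is_interval I" "0 \<in> I" "smooth_on I c" "vderiv 1 c 0 \<noteq> 0"
  shows "arc_length_curvature I \<xi> c 0 = signed_curvature \<xi> c 0"
    and "deriv (arc_length_curvature I \<xi> c) 0 =
      curvature_rate \<xi> (vderiv 1 c 0) (vderiv 2 c 0) (vderiv 3 c 0) / norm (vderiv 1 c 0)"
proof -
  have "continuous_on I (vderiv 1 c)"
    using assms(4) unfolding smooth_on_def
    by (intro differentiable_imp_continuous_on differentiable_at_imp_differentiable_on) auto
  note inv = the_inv_into_arc_length_derivative[OF assms(1-3) this assms(5)]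
  show "arc_length_curvature I \<xi> c 0 = signed_curvature \<xi> c 0"
    by (simp add: arc_length_curvature_def inv(1))
  have "(signed_curvature \<xi> c has_real_derivative
      curvature_rate \<xi> (vderiv 1 c 0) (vderiv 2 c 0) (vderiv 3 c 0)) (at (the_inv_into I (arc_length c) 0))"
    using signed_curvature_derivative[OF assms(4,3,5)] by (simp add: inv(1))
  from DERIV_imp_deriv[OF DERIV_chain2[OF this inv(2)]]
  show "deriv (arc_length_curvature I \<xi> c) 0 =
      curvature_rate \<xi> (vderiv 1 c 0) (vderiv 2 c 0) (vderiv 3 c 0) / norm (vderiv 1 c 0)"
    by (simp add: arc_length_curvature_def[abs_def] divide_inverse)
qed

text \<open>The derivatives of the projected curve are the projected derivatives of \<open>\<gamma>\<close>, and
  projecting does not affect the determinants. So the third derivative of \<open>\<gamma>\<close> enters only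
  through \<open>det3 x z \<xi>\<close>.\<close>

lemma projected_curvature_order_1:
  fixes \<gamma> :: "real \<Rightarrow> real^3"
  assumes "admissible_curve I \<gamma>" "proj \<xi> (vderiv 1 \<gamma> 0) \<noteq> 0"
  defines "v \<equiv> norm (proj \<xi> (vderiv 1 \<gamma> 0))"
    and "x \<equiv> vderiv 1 \<gamma> 0" and "y \<equiv> vderiv 2 \<gamma> 0" and "z \<equiv> vderiv 3 \<gamma> 0"
  shows "arc_length_curvature I \<xi> (proj_curve \<xi> \<gamma>) 0 = det3 x y \<xi> / v ^ 3"
    and "deriv (arc_length_curvature I \<xi> (proj_curve \<xi> \<gamma>)) 0 =
      (det3 x z \<xi> / v ^ 3 - 3 * det3 x y \<xi> * (proj \<xi> y \<bullet> sgn (proj \<xi> x)) / v ^ 4) / v"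
proof -
  have I: "open I" "is_interval I" "0 \<in> I" "smooth_on I \<gamma>"
    using assms(1) by (auto simp: admissible_curve_def)
  note c = vderiv_bounded_linear[OF I(1,4) bounded_linear_proj I(3)]
  note sm = smooth_on_bounded_linear[OF I(1,4) bounded_linear_proj]
  have nz: "vderiv 1 (proj \<xi> \<circ> \<gamma>) 0 \<noteq> 0" using assms(2) by (simp add: c)
  note * = arc_length_curvature_order_1[OF I(1-3) sm nz]
  show "arc_length_curvature I \<xi> (proj_curve \<xi> \<gamma>) 0 = det3 x y \<xi> / v ^ 3"
    unfolding proj_curve_def *(1) by (simp add: signed_curvature_def c det3_proj v_def x_def y_def)
  show "deriv (arc_length_curvature I \<xi> (proj_curve \<xi> \<gamma>)) 0 =
      (det3 x z \<xi> / v ^ 3 - 3 * det3 x y \<xi> * (proj \<xi> y \<bullet> sgn (proj \<xi> x)) / v ^ 4) / v"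
    unfolding proj_curve_def *(2)
    by (simp add: curvature_rate_def c det3_proj v_def x_def y_def z_def)
qed

lemma normal_form_cuspidal_curvature:
  assumes "k \<ge> 3" "admissible_curve I \<gamma>" "normal_form k a b \<gamma>"
  shows "cuspidal_curvature (yz \<circ> proj_curve (vector [1, 0, 0]) \<gamma>) = a 2 * b 3 / a 2 powr (5/2)"
proof -
  let ?L = "\<lambda>x. yz (proj (vector [1, 0, 0]) x)"
  have I: "open I" "0 \<in> I" "smooth_on I \<gamma>" and a2: "a 2 > 0"
    using assms(2,3) by (auto simp: admissible_curve_def normal_form_def)
  have L: "bounded_linear ?L"
    by (intro bounded_linear_compose[OF bounded_linear_yz] bounded_linear_proj)
  have "yz \<circ> proj_curve (vector [1, 0, 0]) \<gamma> = ?L \<circ> \<gamma>"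
    by (simp add: proj_curve_def fun_eq_iff)
  moreover have "?L (vector [0, y, z]) = vector [y, z]" for y z
    by (simp add: yz_def proj_def inner_vec_def sum_3)
  ultimately show ?thesis
    using a2 normal_form_vderiv[OF assms]
    by (simp add: cuspidal_curvature_def vderiv_bounded_linear[OF I(1,3) L I(2)] det2_def det_2
        norm_vec_def L2_set_def sum_2)
qed

theorem theorem2p2:
  fixes \<theta>1 \<theta>2 :: real and \<xi>1 \<xi>2 :: "real^3"
    and k :: nat
    and I I' :: "real set" and \<gamma> \<gamma>' :: "real \<Rightarrow> real^3"
    and a b a' b' :: "nat \<Rightarrow> real"
    and \<mu> \<mu>' :: real and \<kappa> \<kappa>' :: "real \<Rightarrow> real"
  assumes "k \<ge> 3"
    and "\<xi>1 = vector [1, 0, 0]"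
    and "\<xi>2 = vector [sin \<theta>1 * cos \<theta>2, sin \<theta>1 * sin \<theta>2, cos \<theta>1]"
    and "cos \<theta>1 \<noteq> 0"
    and "admissible_curve I \<gamma>" and "normal_form k a b \<gamma>"
    and "oriented_cusp (yz \<circ> proj_curve \<xi>1 \<gamma>)"
    and "\<xi>2 \<notin> span {vderiv 1 \<gamma> 0}"
    and "\<mu> = cuspidal_curvature (yz \<circ> proj_curve \<xi>1 \<gamma>)"
    and "\<kappa> = arc_length_curvature I \<xi>2 (proj_curve \<xi>2 \<gamma>)"
    and "admissible_curve I' \<gamma>'" and "normal_form k a' b' \<gamma>'"
    and "oriented_cusp (yz \<circ> proj_curve \<xi>1 \<gamma>')"
    and "\<xi>2 \<notin> span {vderiv 1 \<gamma>' 0}"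
    and "\<mu>' = cuspidal_curvature (yz \<circ> proj_curve \<xi>1 \<gamma>')"
    and "\<kappa>' = arc_length_curvature I' \<xi>2 (proj_curve \<xi>2 \<gamma>')"
  shows "(\<mu> = \<mu>' \<and> order_info 0 \<kappa> = order_info 0 \<kappa>' \<longrightarrow> a 2 = a' 2 \<and> b 3 = b' 3) \<and>
         (\<mu> = \<mu>' \<and> order_info 1 \<kappa> = order_info 1 \<kappa>' \<longrightarrow> a 3 = a' 3)"
proof -
  define x where "x = (vector [1, 0, 0] :: real^3)"
  define v where "v = norm (proj \<xi>2 x)"
  \<comment> \<open>If the projection vanished, its first coordinate would force \<open>\<xi>2 $ 1 \<noteq> 0\<close>, while its third
    coordinate is \<open>- (\<xi>2 $ 1 * cos \<theta>1)\<close>.\<close>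
  have "proj \<xi>2 x \<noteq> 0"
  proof
    assume "proj \<xi>2 x = 0"
    then have "proj \<xi>2 x $ 1 = 0" "proj \<xi>2 x $ 3 = 0" by simp_all
    then show False
      using assms(4) by (auto simp: proj_def x_def assms(3) inner_vec_def sum_3)
  qed
  then have v: "v > 0" by (simp add: v_def)
  \<comment> \<open>The contribution of the changing speed to the derivative of the curvature.\<close>
  define Q where "Q = (\<lambda>d. 3 * (d * cos \<theta>1) * (proj \<xi>2 (vector [0, d, 0]) \<bullet> sgn (proj \<xi>2 x)) / v ^ 4)"
  have curve: "arc_length_curvature J \<xi>2 (proj_curve \<xi>2 c) 0 = p 2 * cos \<theta>1 / v ^ 3"
    "deriv (arc_length_curvature J \<xi>2 (proj_curve \<xi>2 c)) 0 =
       ((p 3 * cos \<theta>1 - q 3 * (sin \<theta>1 * sin \<theta>2)) / v ^ 3 - Q (p 2)) / v"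
    "p 2 > 0" "cuspidal_curvature (yz \<circ> proj_curve \<xi>1 c) = p 2 * q 3 / p 2 powr (5/2)"
    if adm: "admissible_curve J c" and nf: "normal_form k p q c" for J c p q
  proof -
    note d = normal_form_vderiv[OF assms(1) adm nf]
    have "proj \<xi>2 (vderiv 1 c 0) \<noteq> 0" using \<open>proj \<xi>2 x \<noteq> 0\<close> d(1) by (simp add: x_def)
    note * = projected_curvature_order_1[OF adm this, unfolded d, folded x_def, folded v_def]
    have dets: "det3 x (vector [0, p 2, 0]) \<xi>2 = p 2 * cos \<theta>1"
      "det3 x (vector [0, p 3, q 3]) \<xi>2 = p 3 * cos \<theta>1 - q 3 * (sin \<theta>1 * sin \<theta>2)"
      by (simp_all add: det3_def det_3 x_def assms(3))
    show "arc_length_curvature J \<xi>2 (proj_curve \<xi>2 c) 0 = p 2 * cos \<theta>1 / v ^ 3"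
      "deriv (arc_length_curvature J \<xi>2 (proj_curve \<xi>2 c)) 0 =
       ((p 3 * cos \<theta>1 - q 3 * (sin \<theta>1 * sin \<theta>2)) / v ^ 3 - Q (p 2)) / v"
      by (simp_all add: * dets Q_def)
    show "p 2 > 0" using nf by (simp add: normal_form_def)
    show "cuspidal_curvature (yz \<circ> proj_curve \<xi>1 c) = p 2 * q 3 / p 2 powr (5/2)"
      using normal_form_cuspidal_curvature[OF assms(1) adm nf] by (simp add: assms(2))
  qed
  note c = curve[OF assms(5,6)] and c' = curve[OF assms(11,12)]
  have order_0: "a 2 = a' 2 \<and> b 3 = b' 3" if "\<mu> = \<mu>'" "\<kappa> 0 = \<kappa>' 0"
  proof
    show eq: "a 2 = a' 2"
      using that(2) v assms(4) unfolding assms(10,16) c(1) c'(1) by simp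
    show "b 3 = b' 3"
      using that(1) c(3) unfolding assms(9,15) c(4) c'(4) eq[symmetric] by simp
  qed
  have order_1: "a 3 = a' 3" if "\<mu> = \<mu>'" "\<kappa> 0 = \<kappa>' 0" "deriv \<kappa> 0 = deriv \<kappa>' 0"
    using that(3) v assms(4) order_0[OF that(1,2)] unfolding assms(10,16) c(2) c'(2) by simp
  show ?thesis
    using order_0 order_1 by (simp add: order_info_def)
qed

end
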